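(* Let $q$ be a prime power, $n\geq1$, $1\neq\sigma\in\mathrm{Aut}(\mathbb F_q)$ with fixed field $\mathbb F_s$, and let $\mathcal C(\Lambda_\sigma)=\{c_M:M\in M_{n+1}(q)\}$ be as in the context. Then $\mathrm{GL}(n+1,q)$ acts as a group of automorphisms (Hamming isometries preserving the code) of $\mathcal C(\Lambda_\sigma)$ via $\varrho(g): c_M\mapsto c_{g^{-1}Mg^\sigma}$, and the kernel of this action is the subgroup $K_\sigma=\{\alpha I:\alpha\in\mathbb F_s\}$ of scalar matrices.
   Context: $V=\mathbb F_q^{n+1}$ (column vectors), $V^*$ row vectors; $A^\sigma$ means $\sigma$ applied entrywise. $\Lambda_\sigma=\{[x^\sigma\xi]: x\in V\setminus\{0\},\xi\in V^*\setminus\{0\},\xi x=0\}\subseteq\mathrm{PG}(M_{n+1}(q))$ with fixed representatives $X_1,\dots,X_N$ of its points, and $c_M=(\mathrm{Tr}(X_1M),\dots,\mathrm{Tr}(X_NM))\in\mathbb F_q^N$. *)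

theory Defs
  imports "HOL-Analysis.Analysis" "HOL-Algebra.Coset"
begin

text \<open>
  Throughout, the field is a type \<open>'a::{field,finite}\<close>. Column vectors have type \<open>'a^1^'n\<close>,
  row vectors have type \<open>'a^'n^1\<close>, and \<open>map_matrix \<sigma> A\<close> is the entrywise image of \<open>A\<close>.
\<close>

definition field_automorphism :: "('a::field \<Rightarrow> 'a) \<Rightarrow> bool" where
  "field_automorphism \<sigma> \<longleftrightarrow> bij \<sigma> \<and> \<sigma> 1 = 1 \<and>
     (\<forall>x y. \<sigma> (x + y) = \<sigma> x + \<sigma> y) \<and> (\<forall>x y. \<sigma> (x * y) = \<sigma> x * \<sigma> y)"

definition fixed_field :: "('a::field \<Rightarrow> 'a) \<Rightarrow> 'a set" where
  "fixed_field \<sigma> = {a. \<sigma> a = a}"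

text \<open>The subspace spanned by \<open>A\<close>; it is a point of the projective space when \<open>A \<noteq> 0\<close>.\<close>

definition proj_point :: "'a::field^'n^'m \<Rightarrow> ('a^'n^'m) set" where
  "proj_point A = {map_matrix (\<lambda>t. a * t) A | a. True}"

definition Lambda :: "('a::field \<Rightarrow> 'a) \<Rightarrow> ('a^'n^'n) set set" where
  "Lambda \<sigma> = {proj_point (map_matrix \<sigma> x ** \<xi>) | (x :: 'a^1^'n) (\<xi> :: 'a^'n^1).
     x \<noteq> 0 \<and> \<xi> \<noteq> 0 \<and> \<xi> ** x = 0}"

text \<open>
  The family \<open>X\<close> contains exactly one representative of each point of \<open>P\<close>. In particular the
  finite index type \<open>'k\<close> has as many elements as \<open>P\<close>, so that \<open>'a^'k\<close> is the ambient space of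
  the code.
\<close>

definition representatives :: "('k::finite \<Rightarrow> 'a::field^'n^'n) \<Rightarrow> ('a^'n^'n) set set \<Rightarrow> bool" where
  "representatives X P \<longleftrightarrow> bij_betw (\<lambda>i. proj_point (X i)) UNIV P"

definition codeword :: "('k::finite \<Rightarrow> 'a::field^'n^'n) \<Rightarrow> 'a^'n^'n \<Rightarrow> 'a^'k" where
  "codeword X M = (\<chi> i. trace (X i ** M))"

definition code :: "('k::finite \<Rightarrow> 'a::field^'n^'n) \<Rightarrow> ('a^'k) set" where
  "code X = range (codeword X)"

definition hamming_dist :: "'a^'k::finite \<Rightarrow> 'a^'k \<Rightarrow> nat" where
  "hamming_dist u v = card {i. u $ i \<noteq> v $ i}"

definition hamming_isometry :: "('a::field^'k::finite \<Rightarrow> 'a^'k) \<Rightarrow> bool" where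
  "hamming_isometry f \<longleftrightarrow> Vector_Spaces.linear (*s) (*s) f \<and> bij f \<and>
     (\<forall>u v. hamming_dist (f u) (f v) = hamming_dist u v)"

text \<open>
  Automorphisms of a code \<open>C\<close> are the maps induced on \<open>C\<close> by the linear Hamming isometries of the
  ambient space that preserve \<open>C\<close>. Products are read from left to right (\<open>f\<close> first, then \<open>h\<close>),
  so that a homomorphism into this group is a right action: since
  \<open>(g h)\<^sup>-\<^sup>1 M (g h)\<^sup>\<sigma> = h\<^sup>-\<^sup>1 (g\<^sup>-\<^sup>1 M g\<^sup>\<sigma>) h\<^sup>\<sigma>\<close>, this is the order in which twisted conjugation composes.
\<close>

definition code_aut :: "('a::field^'k::finite) set \<Rightarrow> ('a^'k \<Rightarrow> 'a^'k) monoid" where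
  "code_aut C =
     \<lparr>carrier = {restrict f C | f. hamming_isometry f \<and> f ` C = C},
      mult = (\<lambda>f h. compose C h f), one = restrict id C\<rparr>"

definition GL :: "('a::field^'n^'n) monoid" where
  "GL = \<lparr>carrier = {g. invertible g}, mult = (**), one = mat 1\<rparr>"

definition K_scalars :: "('a::field \<Rightarrow> 'a) \<Rightarrow> ('a^'n^'n) set" where
  "K_scalars \<sigma> = {mat \<alpha> | \<alpha>. \<alpha> \<in> fixed_field \<sigma> \<and> \<alpha> \<noteq> 0}"

end

theory Submission
  imports Defs
begin

text \<open>
  Since \<open>Tr(X g\<^sup>-\<^sup>1 M g\<^sup>\<sigma>) = Tr(g\<^sup>\<sigma> X g\<^sup>-\<^sup>1 M)\<close> and
  \<open>g\<^sup>\<sigma> (x\<^sup>\<sigma> \<xi>) g\<^sup>-\<^sup>1 = (g x)\<^sup>\<sigma> (\<xi> g\<^sup>-\<^sup>1)\<close> with \<open>(\<xi> g\<^sup>-\<^sup>1) (g x) = \<xi> x\<close>, the map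
  \<open>X \<mapsto> g\<^sup>\<sigma> X g\<^sup>-\<^sup>1\<close> permutes the points of \<open>\<Lambda>\<^sub>\<sigma>\<close>, so \<open>\<rho>(g)\<close> is induced by a monomial map.
  By nondegeneracy of the trace form, \<open>g\<close> acts trivially iff \<open>g\<^sup>\<sigma> X g\<^sup>-\<^sup>1 = X\<close> for every
  representative \<open>X\<close>. Such a \<open>g\<close> fixes every line \<open>\<langle>x\<rangle>\<close>, so \<open>g = \<alpha> I\<close>, and then
  \<open>\<alpha>\<^sup>\<sigma> \<alpha>\<^sup>-\<^sup>1 = 1\<close>.
\<close>

section \<open>Matrix inverses and the general linear group\<close>

lemma matrix_inv_inverse:
  fixes g :: "'a::field^'n^'n"
  assumes "invertible g"
  shows "matrix_inv g ** g = mat 1" "g ** matrix_inv g = mat 1"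
  using someI_ex[OF assms[unfolded invertible_def]] by (simp_all add: matrix_inv_def)

lemma matrix_inv_unique':
  fixes g h :: "'a::field^'n^'n"
  assumes "g ** h = mat 1" "h ** g = mat 1"
  shows "matrix_inv g = h"
proof -
  have "invertible g" using assms invertible_def by blast
  then have "matrix_inv g ** (g ** h) = h"
    by (simp add: matrix_mul_assoc matrix_inv_inverse)
  then show ?thesis by (simp add: assms)
qed

lemma matrix_inv_mult:
  fixes g h :: "'a::field^'n^'n"
  assumes "invertible g" "invertible h"
  shows "matrix_inv (g ** h) = matrix_inv h ** matrix_inv g"
proof (rule matrix_inv_unique')
  have "(g ** h) ** (matrix_inv h ** matrix_inv g) = g ** (h ** matrix_inv h) ** matrix_inv g"
    by (simp add: matrix_mul_assoc)
  then show "(g ** h) ** (matrix_inv h ** matrix_inv g) = mat 1"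
    by (simp add: matrix_inv_inverse assms)
  have "(matrix_inv h ** matrix_inv g) ** (g ** h) = matrix_inv h ** (matrix_inv g ** g) ** h"
    by (simp add: matrix_mul_assoc)
  then show "(matrix_inv h ** matrix_inv g) ** (g ** h) = mat 1"
    by (simp add: matrix_inv_inverse assms)
qed

lemma group_GL: "group (GL :: ('a::field^'n^'n) monoid)"
proof (rule groupI)
  fix g :: "'a^'n^'n" assume "g \<in> carrier GL"
  then have "invertible g" by (simp add: GL_def)
  then have "invertible (matrix_inv g)" "matrix_inv g ** g = mat 1"
    using matrix_inv_inverse invertible_def by blast+
  then show "\<exists>h \<in> carrier GL. h \<otimes>\<^bsub>GL\<^esub> g = \<one>\<^bsub>GL\<^esub>"
    by (auto simp: GL_def)
next
  fix g h :: "'a^'n^'n" assume "g \<in> carrier GL" "h \<in> carrier GL"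
  then show "g \<otimes>\<^bsub>GL\<^esub> h \<in> carrier GL" by (simp add: GL_def invertible_mult)
qed (auto simp: GL_def matrix_mul_assoc invertible_def)

section \<open>Nondegeneracy of the trace form\<close>

text \<open>Pairing \<open>D\<close> with the matrix unit that has its 1 in row \<open>j\<close> and
  column \<open>i\<close> isolates the entry \<open>D $ i $ j\<close>. This turns equality of
  codewords for all \<open>M\<close> into equality of matrices.\<close>

lemma eq_if_trace_mult_eq:
  fixes A B :: "'a::field^'n^'n"
  assumes "\<And>M. trace (A ** M) = trace (B ** M)"
  shows "A = B"
proof -
  have "trace (D ** (\<chi> k l. if l = i \<and> k = j then 1 else 0)) = D $ i $ j"
    for D :: "'a^'n^'n" and i j
  proof -
    have "(\<Sum>k\<in>UNIV. D $ l $ k * (if l = i \<and> k = j then 1 else 0)) = (if l = i then D $ i $ j else 0)"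
      for l
      by (cases "l = i") (simp_all add: if_distrib cong: if_cong)
    then show ?thesis by (simp add: trace_def matrix_matrix_mult_def)
  qed
  then show ?thesis using assms by (metis vec_eq_iff)
qed

section \<open>Scalar multiples and scalar matrices\<close>

lemma map_matrix_scale_mult:
  fixes A :: "'a::field^'n^'m" and B :: "'a^'p^'n"
  shows "map_matrix ((*) c) A ** B = map_matrix ((*) c) (A ** B)"
    and "A ** map_matrix ((*) c) B = map_matrix ((*) c) (A ** B)"
  by (simp_all add: vec_eq_iff map_matrix_def matrix_matrix_mult_def sum_distrib_left algebra_simps)

lemma trace_scale: "trace (map_matrix ((*) c) A) = c * trace (A :: 'a::field^'n^'n)"
  by (simp add: trace_def map_matrix_def sum_distrib_left)

lemma map_matrix_scale_scale:
  "map_matrix ((*) a) (map_matrix ((*) b) A) = map_matrix ((*) (a * b)) (A :: 'a::field^'n^'m)"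
  by (simp add: vec_eq_iff map_matrix_def algebra_simps)

lemma map_matrix_one: "map_matrix ((*) 1) A = (A :: 'a::field^'n^'m)"
  by (simp add: vec_eq_iff map_matrix_def)

lemma mat_mult_eq_scale:
  fixes A :: "'a::field^'n^'m"
  shows "mat \<alpha> ** A = map_matrix ((*) \<alpha>) A"
    and "A ** mat \<alpha> = map_matrix ((*) \<alpha>) A"
  by (simp_all add: vec_eq_iff map_matrix_def matrix_matrix_mult_def mat_def
      if_distrib [where f = "\<lambda>x. x * _"] if_distrib [where f = "\<lambda>x. _ * x"] algebra_simps
      cong: if_cong)

lemma invertible_mat_iff: "invertible (mat \<alpha> :: 'a::field^'n^'n) \<longleftrightarrow> \<alpha> \<noteq> 0"
  and matrix_inv_mat: "\<alpha> \<noteq> 0 \<Longrightarrow> matrix_inv (mat \<alpha> :: 'a^'n^'n) = mat (inverse \<alpha>)"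
proof -
  have mult: "mat a ** mat b = (mat (a * b) :: 'a^'n^'n)" for a b :: 'a
    by (simp add: mat_mult_eq_scale(1)) (simp add: vec_eq_iff map_matrix_def mat_def)
  show "matrix_inv (mat \<alpha> :: 'a^'n^'n) = mat (inverse \<alpha>)" if "\<alpha> \<noteq> 0"
    using that by (intro matrix_inv_unique') (simp_all add: mult)
  show "invertible (mat \<alpha> :: 'a^'n^'n) \<longleftrightarrow> \<alpha> \<noteq> 0"
  proof
    show "invertible (mat \<alpha> :: 'a^'n^'n)" if "\<alpha> \<noteq> 0"
      using that mult[of \<alpha> "inverse \<alpha>"] mult[of "inverse \<alpha>" \<alpha>] unfolding invertible_def by auto
    show "\<alpha> \<noteq> 0" if "invertible (mat \<alpha> :: 'a^'n^'n)"
    proof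
      assume "\<alpha> = 0"
      then obtain B where "mat 0 ** B = (mat 1 :: 'a^'n^'n)"
        using \<open>invertible (mat \<alpha> :: 'a^'n^'n)\<close> invertible_def by blast
      then have "(mat 1 :: 'a^'n^'n) = 0"
        by (metis mat_0 times0_left)
      then have "(mat 1 :: 'a^'n^'n) $ i $ i = 0" for i by simp
      then show False by (simp add: mat_def)
    qed
  qed
qed

section \<open>Points of projective space and their representatives\<close>

lemma proj_point_scale:
  fixes A :: "'a::field^'n^'m"
  assumes "c \<noteq> 0"
  shows "proj_point (map_matrix ((*) c) A) = proj_point A"
proof -
  \<comment> \<open>Dividing the factor by \<open>c\<close> reparametrizes the line, so every
    multiple of \<open>A\<close> is also a multiple of its scaled copy.\<close>
  have "\<exists>b. map_matrix ((*) a) A = map_matrix ((*) (b * c)) A" for a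
    using assms by (intro exI[of _ "a / c"]) simp
  then show ?thesis
    unfolding proj_point_def by (auto simp: map_matrix_scale_scale)
qed

lemma proj_point_eqD:
  fixes A B :: "'a::field^'n^'m"
  assumes "proj_point A = proj_point B" "A \<noteq> 0"
  obtains c where "c \<noteq> 0" "A = map_matrix ((*) c) B"
proof -
  have "A \<in> proj_point A"
    unfolding proj_point_def using map_matrix_one[of A] by (metis (mono_tags, lifting) mem_Collect_eq)
  then obtain c where c: "A = map_matrix ((*) c) B"
    using assms(1) unfolding proj_point_def by auto
  then have "c \<noteq> 0" using assms(2) by (auto simp: vec_eq_iff map_matrix_def)
  with c show ?thesis using that by blast
qed

section \<open>Field automorphisms applied entrywise\<close>

lemma field_automorphism_0:
  assumes "field_automorphism \<sigma>" shows "\<sigma> 0 = 0"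
proof -
  have "\<sigma> (0 + 0) = \<sigma> 0 + \<sigma> 0" using assms unfolding field_automorphism_def by blast
  then show ?thesis by (metis add_0 add_cancel_right_right)
qed

lemma field_automorphism_eq_0_iff:
  assumes "field_automorphism \<sigma>" shows "\<sigma> x = 0 \<longleftrightarrow> x = 0"
  using assms field_automorphism_0[OF assms]
  unfolding field_automorphism_def by (metis bij_def inj_eq)

lemma field_automorphism_sum:
  assumes "field_automorphism \<sigma>" shows "\<sigma> (sum f A) = (\<Sum>i\<in>A. \<sigma> (f i))"
  using assms field_automorphism_0[OF assms]
  by (induction A rule: infinite_finite_induct) (auto simp: field_automorphism_def)

lemma map_matrix_automorphism_mult:
  fixes A :: "'a::field^'n^'m" and B :: "'a^'p^'n"
  assumes "field_automorphism \<sigma>"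
  shows "map_matrix \<sigma> (A ** B) = map_matrix \<sigma> A ** map_matrix \<sigma> B"
  using assms
  by (simp add: vec_eq_iff map_matrix_def matrix_matrix_mult_def field_automorphism_sum[OF assms])
    (simp add: field_automorphism_def)

lemma map_matrix_automorphism_mat:
  assumes "field_automorphism \<sigma>"
  shows "map_matrix \<sigma> (mat \<alpha>) = mat (\<sigma> \<alpha>)"
  using field_automorphism_0[OF assms] by (simp add: vec_eq_iff map_matrix_def mat_def)

text \<open>Entrywise application of \<sigma> is multiplicative and fixes the identity matrix, so it
  carries inverses to inverses.\<close>

lemma map_matrix_automorphism_inv:
  fixes g :: "'a::field^'n^'n"
  assumes "field_automorphism \<sigma>" "invertible g"
  shows "map_matrix \<sigma> g ** map_matrix \<sigma> (matrix_inv g) = mat 1"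
    and "map_matrix \<sigma> (matrix_inv g) ** map_matrix \<sigma> g = mat 1"
  using assms
  by (simp_all add: matrix_inv_inverse map_matrix_automorphism_mat field_automorphism_def
      flip: map_matrix_automorphism_mult)

section \<open>Matrices that represent points of \<open>Lambda\<close>\<close>

text \<open>The points of \<open>Lambda\<close> lifted to actual matrices, so that scaling and
  twisted conjugation can be computed without passing to lines. The pair \<open>x\<close>,
  \<open>\<xi>\<close> describes an incident point and hyperplane, hence the name.\<close>

definition flag_matrices :: "('a::field \<Rightarrow> 'a) \<Rightarrow> ('a^'n^'n) set" where
  "flag_matrices \<sigma> = {map_matrix \<sigma> x ** \<xi> | (x :: 'a^1^'n) (\<xi> :: 'a^'n^1).
     x \<noteq> 0 \<and> \<xi> \<noteq> 0 \<and> \<xi> ** x = 0}"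

lemma Lambda_eq_image: "Lambda \<sigma> = proj_point ` flag_matrices \<sigma>"
  unfolding Lambda_def flag_matrices_def by blast

lemma column_times_row_nth: "(x ** \<xi>) $ i $ j = x $ i $ 1 * (\<xi> :: 'a::field^'n^1) $ 1 $ j"
  by (simp add: matrix_matrix_mult_def)

lemma flag_matrices_nonzero:
  fixes A :: "'a::field^'n^'n"
  assumes "field_automorphism \<sigma>" "A \<in> flag_matrices \<sigma>"
  shows "A \<noteq> 0"
proof -
  obtain x :: "'a^1^'n" and \<xi> :: "'a^'n^1"
    where A: "A = map_matrix \<sigma> x ** \<xi>" "x \<noteq> 0" "\<xi> \<noteq> 0"
    using assms(2) unfolding flag_matrices_def by blast
  obtain i j where "x $ i $ 1 \<noteq> 0" "\<xi> $ 1 $ j \<noteq> 0"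
    using A(2,3) by (auto simp: vec_eq_iff num1_eq1)
  then have "A $ i $ j \<noteq> 0"
    by (simp add: A(1) column_times_row_nth map_matrix_def field_automorphism_eq_0_iff[OF assms(1)])
  then show ?thesis by auto
qed

text \<open>The scalar is absorbed into \<open>\<xi>\<close>, which enters untwisted; moving it into
  \<open>x\<close> would require a preimage under \<sigma>.\<close>

lemma flag_matrices_scale:
  fixes A :: "'a::field^'n^'n"
  assumes "c \<noteq> 0" "A \<in> flag_matrices \<sigma>"
  shows "map_matrix ((*) c) A \<in> flag_matrices \<sigma>"
proof -
  obtain x :: "'a^1^'n" and \<xi> :: "'a^'n^1"
    where A: "A = map_matrix \<sigma> x ** \<xi>" "x \<noteq> 0" "\<xi> \<noteq> 0" "\<xi> ** x = 0"
    using assms(2) unfolding flag_matrices_def by blast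
  have "map_matrix ((*) c) A = map_matrix \<sigma> x ** map_matrix ((*) c) \<xi>"
    by (simp add: A(1) map_matrix_scale_mult)
  moreover have "map_matrix ((*) c) \<xi> \<noteq> 0"
    using A(3) assms(1) by (auto simp: vec_eq_iff map_matrix_def)
  moreover have "map_matrix ((*) c) \<xi> ** x = 0"
    using A(4) by (simp add: map_matrix_scale_mult) (simp add: vec_eq_iff map_matrix_def)
  ultimately show ?thesis using A(2) unfolding flag_matrices_def by blast
qed

lemma flag_matrices_twisted_conj:
  fixes A g :: "'a::field^'n^'n"
  assumes "field_automorphism \<sigma>" "invertible g" "A \<in> flag_matrices \<sigma>"
  shows "map_matrix \<sigma> g ** A ** matrix_inv g \<in> flag_matrices \<sigma>"
proof -
  obtain x :: "'a^1^'n" and \<xi> :: "'a^'n^1"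
    where A: "A = map_matrix \<sigma> x ** \<xi>" "x \<noteq> 0" "\<xi> \<noteq> 0" "\<xi> ** x = 0"
    using assms(3) unfolding flag_matrices_def by blast
  \<comment> \<open>Undoing the transformation recovers \<open>x\<close> and \<open>\<xi>\<close>,
    so neither transformed vector can vanish.\<close>
  have "matrix_inv g ** (g ** x) = x"
    by (simp add: matrix_mul_assoc matrix_inv_inverse[OF assms(2)])
  moreover have "(\<xi> ** matrix_inv g) ** g = \<xi>"
    by (simp add: matrix_inv_inverse[OF assms(2)] flip: matrix_mul_assoc)
  ultimately have "g ** x \<noteq> 0" "\<xi> ** matrix_inv g \<noteq> 0" "(\<xi> ** matrix_inv g) ** (g ** x) = 0"
    using A(2-4) by (metis times0_left times0_right matrix_mul_assoc)+
  moreover have "map_matrix \<sigma> g ** A ** matrix_inv g = map_matrix \<sigma> (g ** x) ** (\<xi> ** matrix_inv g)"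
    by (simp add: A(1) map_matrix_automorphism_mult[OF assms(1)] matrix_mul_assoc)
  ultimately show ?thesis unfolding flag_matrices_def by blast
qed

text \<open>The hypothesis on \<open>X\<close> only prescribes the line of \<open>X i\<close>. A
  flag matrix on that line is a nonzero multiple of \<open>X i\<close>, and dividing by the factor
  stays inside the scaling-invariant set.\<close>

lemma representatives_in_flag_matrices:
  fixes X :: "'k::finite \<Rightarrow> 'a::field^'n^'n"
  assumes "field_automorphism \<sigma>" "representatives X (Lambda \<sigma>)"
  shows "X i \<in> flag_matrices \<sigma>"
proof -
  obtain A where A: "A \<in> flag_matrices \<sigma>" "proj_point A = proj_point (X i)"
    using assms(2) unfolding representatives_def bij_betw_def Lambda_eq_image
    by (metis (no_types, lifting) imageE rangeI)
  then obtain c where c: "c \<noteq> 0" "A = map_matrix ((*) c) (X i)"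
    using proj_point_eqD flag_matrices_nonzero[OF assms(1)] by metis
  then have "X i = map_matrix ((*) (inverse c)) A"
    by (simp add: map_matrix_scale_scale map_matrix_one)
  then show ?thesis using flag_matrices_scale[OF _ A(1), of "inverse c"] c by simp
qed

text \<open>Surjectivity onto the points: it transfers linear identities from the representatives to
  all flag matrices.\<close>

lemma flag_matrix_multiple_of_representative:
  fixes X :: "'k::finite \<Rightarrow> 'a::field^'n^'n"
  assumes "field_automorphism \<sigma>" "representatives X (Lambda \<sigma>)" "A \<in> flag_matrices \<sigma>"
  shows "\<exists>i c. c \<noteq> 0 \<and> A = map_matrix ((*) c) (X i)"
proof -
  have "proj_point A \<in> range (\<lambda>i. proj_point (X i))"
    using assms(2,3) unfolding representatives_def bij_betw_def Lambda_eq_image by blast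
  then obtain i where "proj_point A = proj_point (X i)" by blast
  then show ?thesis
    using proj_point_eqD flag_matrices_nonzero[OF assms(1,3)] by metis
qed

section \<open>Hamming isometries and the automorphism group of a code\<close>

text \<open>Nonzero factors do not affect whether two coordinates agree, so \<open>\<pi>\<close>
  maps the positions where the images differ bijectively onto those where \<open>u\<close> and
  \<open>v\<close> differ.\<close>

lemma hamming_isometry_monomial:
  fixes c :: "'k::finite \<Rightarrow> 'a::field"
  assumes "\<And>i. c i \<noteq> 0" "bij \<pi>"
  shows "hamming_isometry (\<lambda>u. \<chi> i. c i * u $ \<pi> i)" (is "hamming_isometry ?f")
proof -
  have "Vector_Spaces.linear (*s) (*s) ?f"
    by (simp add: Vector_Spaces.linear_iff vec.vector_space_axioms vec_eq_iff algebra_simps)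
  moreover have "bij ?f"
  proof (rule o_bij)
    \<comment> \<open>The inverse is again monomial: it permutes back and divides by the factor
      attached to the original position.\<close>
    show "(\<lambda>u. \<chi> j. u $ inv_into UNIV \<pi> j / c (inv_into UNIV \<pi> j)) \<circ> ?f = id"
      using assms by (simp add: fun_eq_iff vec_eq_iff surj_f_inv_f bij_is_surj)
    show "?f \<circ> (\<lambda>u. \<chi> j. u $ inv_into UNIV \<pi> j / c (inv_into UNIV \<pi> j)) = id"
      using assms by (simp add: fun_eq_iff vec_eq_iff inv_f_f bij_is_inj)
  qed
  moreover have "hamming_dist (?f u) (?f v) = hamming_dist u v" for u v
  proof -
    have "bij_betw \<pi> {i. ?f u $ i \<noteq> ?f v $ i} {i. u $ i \<noteq> v $ i}"
      using assms unfolding bij_def bij_betw_def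
      by (auto intro: inj_onI dest: injD)
    then show ?thesis unfolding hamming_dist_def by (rule bij_betw_same_card)
  qed
  ultimately show ?thesis unfolding hamming_isometry_def by blast
qed

lemma hamming_isometry_id: "hamming_isometry (id :: 'a::field^'k::finite \<Rightarrow> _)"
  unfolding hamming_isometry_def by (simp add: vec.linear_id)

lemma hamming_isometry_comp:
  assumes "hamming_isometry f" "hamming_isometry h"
  shows "hamming_isometry (f \<circ> h)"
  using assms unfolding hamming_isometry_def
  by (auto intro: bij_comp Vector_Spaces.linear_compose)

lemma hamming_isometry_inv:
  fixes f :: "'a::field^'k::finite \<Rightarrow> 'a^'k"
  assumes "hamming_isometry f"
  shows "hamming_isometry (inv_into UNIV f)"
proof -
  have f: "Vector_Spaces.linear (*s) (*s) f" "bij f"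
    and d: "\<And>u v. hamming_dist (f u) (f v) = hamming_dist u v"
    using assms unfolding hamming_isometry_def by auto
  have ff: "f (inv_into UNIV f u) = u" for u using f(2) by (simp add: bij_is_surj surj_f_inv_f)
  have "Vector_Spaces.linear (*s) (*s) (inv_into UNIV f)"
    using f bij_is_inj[OF f(2)] ff
    by (simp add: Vector_Spaces.linear_iff vec.vector_space_axioms) (metis inv_f_f)
  moreover have "hamming_dist (inv_into UNIV f u) (inv_into UNIV f v) = hamming_dist u v" for u v
    using d[of "inv_into UNIV f u" "inv_into UNIV f v"] by (simp add: ff)
  ultimately show ?thesis
    using f(2) unfolding hamming_isometry_def by (simp add: bij_imp_bij_inv)
qed

text \<open>Since \<open>f\<close> keeps \<open>C\<close> inside \<open>C\<close>, the restriction
  of \<open>h\<close> is only evaluated where it agrees with \<open>h\<close>. Products in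
  \<open>code_aut\<close> thus become restrictions of composed ambient isometries.\<close>

lemma compose_restrict_restrict:
  assumes "f ` C \<subseteq> C"
  shows "compose C (restrict h C) (restrict f C) = restrict (h \<circ> f) C"
  using assms by (auto simp: compose_def restrict_def fun_eq_iff)

lemma group_code_aut: "group (code_aut C)"
proof (rule groupI)
  fix a b assume "a \<in> carrier (code_aut C)" "b \<in> carrier (code_aut C)"
  then obtain f h where "a = restrict f C" "hamming_isometry f" "f ` C = C"
    "b = restrict h C" "hamming_isometry h" "h ` C = C"
    unfolding code_aut_def by auto
  then have "a \<otimes>\<^bsub>code_aut C\<^esub> b = restrict (h \<circ> f) C" "hamming_isometry (h \<circ> f)" "(h \<circ> f) ` C = C"
    by (simp_all add: code_aut_def compose_restrict_restrict hamming_isometry_comp del: o_apply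
        flip: image_comp)
  then show "a \<otimes>\<^bsub>code_aut C\<^esub> b \<in> carrier (code_aut C)"
    unfolding code_aut_def by (auto intro!: exI[of _ "h \<circ> f"])
next
  show "\<one>\<^bsub>code_aut C\<^esub> \<in> carrier (code_aut C)"
    unfolding code_aut_def using hamming_isometry_id by (auto intro!: exI[of _ id])
next
  fix a b c
  assume "a \<in> carrier (code_aut C)" "b \<in> carrier (code_aut C)" "c \<in> carrier (code_aut C)"
  then show "a \<otimes>\<^bsub>code_aut C\<^esub> b \<otimes>\<^bsub>code_aut C\<^esub> c = a \<otimes>\<^bsub>code_aut C\<^esub> (b \<otimes>\<^bsub>code_aut C\<^esub> c)"
    unfolding code_aut_def by (auto simp: compose_def restrict_def fun_eq_iff)
next
  fix a assume "a \<in> carrier (code_aut C)"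
  then show "\<one>\<^bsub>code_aut C\<^esub> \<otimes>\<^bsub>code_aut C\<^esub> a = a"
    unfolding code_aut_def by (auto simp: compose_def restrict_def fun_eq_iff)
next
  fix a assume "a \<in> carrier (code_aut C)"
  then obtain f where f: "a = restrict f C" "hamming_isometry f" "f ` C = C"
    unfolding code_aut_def by auto
  have "bij f" using f(2) unfolding hamming_isometry_def by blast
  have "inv_into UNIV f ` C = inv_into UNIV f ` (f ` C)" by (simp add: f(3))
  also have "\<dots> = C" using \<open>bij f\<close> by (simp add: image_inv_f_f bij_is_inj)
  finally have C: "inv_into UNIV f ` C = C" .
  have "restrict (inv_into UNIV f) C \<in> carrier (code_aut C)"
    unfolding code_aut_def using hamming_isometry_inv[OF f(2)] C by auto
  moreover have "restrict (inv_into UNIV f) C \<otimes>\<^bsub>code_aut C\<^esub> a = \<one>\<^bsub>code_aut C\<^esub>"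
    using \<open>bij f\<close> C f(1) surj_iff[of f]
    by (simp add: code_aut_def compose_restrict_restrict bij_is_surj)
  ultimately show "\<exists>b \<in> carrier (code_aut C). b \<otimes>\<^bsub>code_aut C\<^esub> a = \<one>\<^bsub>code_aut C\<^esub>"
    by blast
qed

section \<open>Twisted conjugation as a monomial map on codewords\<close>

text \<open>The isometry must live on the whole ambient space and be the same for all
  \<open>M\<close>. Its factors and permutation are read off from how conjugation by
  \<open>g\<close> moves the representatives.\<close>

lemma codeword_twisted_conj_isometry:
  fixes X :: "'k::finite \<Rightarrow> 'a::field^'n^'n"
  assumes \<sigma>: "field_automorphism \<sigma>" and X: "representatives X (Lambda \<sigma>)"
    and g: "invertible g"
  shows "\<exists>f. hamming_isometry f \<and>
    (\<forall>M. f (codeword X M) = codeword X (matrix_inv g ** M ** map_matrix \<sigma> g))"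
proof -
  have "\<forall>i. \<exists>j c. c \<noteq> 0 \<and> map_matrix \<sigma> g ** X i ** matrix_inv g = map_matrix ((*) c) (X j)"
    using flag_matrix_multiple_of_representative[OF \<sigma> X] flag_matrices_twisted_conj[OF \<sigma> g]
      representatives_in_flag_matrices[OF \<sigma> X] by blast
  then obtain \<pi> c where c: "\<And>i. c i \<noteq> 0"
    and conj: "\<And>i. map_matrix \<sigma> g ** X i ** matrix_inv g = map_matrix ((*) (c i)) (X (\<pi> i))"
    by metis
  \<comment> \<open>Solving for \<open>X i\<close> shows that its line depends only on
    \<open>\<pi> i\<close>, which gives injectivity of \<open>\<pi>\<close>; bijectivity follows
    because the index type is finite.\<close>
  have X_eq: "X i = map_matrix ((*) (c i)) (map_matrix \<sigma> (matrix_inv g) ** X (\<pi> i) ** g)" for i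
  proof -
    have "map_matrix \<sigma> (matrix_inv g) ** (map_matrix \<sigma> g ** X i ** matrix_inv g) ** g
        = (map_matrix \<sigma> (matrix_inv g) ** map_matrix \<sigma> g) ** X i ** (matrix_inv g ** g)"
      by (simp add: matrix_mul_assoc)
    then show ?thesis
      by (simp add: conj map_matrix_automorphism_inv \<sigma> g matrix_inv_inverse map_matrix_scale_mult)
  qed
  have "inj \<pi>"
  proof (rule injI)
    fix i j assume "\<pi> i = \<pi> j"
    then have "proj_point (X i) = proj_point (X j)"
      using X_eq[of i] X_eq[of j] proj_point_scale c by metis
    then show "i = j"
      using X unfolding representatives_def bij_betw_def by (auto dest: injD)
  qed
  then have "bij \<pi>" by (simp add: bij_def finite_UNIV_inj_surj)
  have "(\<chi> i. c i * codeword X M $ \<pi> i) = codeword X (matrix_inv g ** M ** map_matrix \<sigma> g)" for M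
  proof (simp add: vec_eq_iff codeword_def, rule allI)
    fix i
    \<comment> \<open>The factor \<open>c i\<close> is absorbed into the conjugate of
      \<open>X i\<close>; cyclicity of the trace then moves the twisted \<open>g\<close> to the
      right end.\<close>
    have "c i * trace (X (\<pi> i) ** M) = trace (map_matrix \<sigma> g ** (X i ** matrix_inv g ** M))"
      by (simp add: matrix_mul_assoc conj map_matrix_scale_mult trace_scale)
    also have "\<dots> = trace (X i ** (matrix_inv g ** M ** map_matrix \<sigma> g))"
      by (subst trace_mul_sym) (simp add: matrix_mul_assoc)
    finally show "c i * trace (X (\<pi> i) ** M) = trace (X i ** (matrix_inv g ** M ** map_matrix \<sigma> g))" .
  qed
  with hamming_isometry_monomial[OF c \<open>bij \<pi>\<close>] show ?thesis
    by (intro exI[of _ "\<lambda>u. \<chi> i. c i * u $ \<pi> i"] conjI allI)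
qed

section \<open>Matrices that fix every flag matrix\<close>

text \<open>A nonzero product of a column and a row determines the line of the column, so
  \<open>g\<close> preserves the line of every \<open>x\<close> that occurs in a flag. Unit vectors
  and sums of two of them suffice to make \<open>g\<close> scalar. The bound on the dimension
  provides two distinct indices, from which flags are built.\<close>

lemma twisted_conj_fixes_flags_imp_scalar:
  fixes g :: "'a::field^'n^'n"
  assumes \<sigma>: "field_automorphism \<sigma>" and g: "invertible g" and n: "CARD('n) \<ge> 2"
    and stab: "\<And>A. A \<in> flag_matrices \<sigma> \<Longrightarrow> map_matrix \<sigma> g ** A ** matrix_inv g = A"
  shows "g \<in> K_scalars \<sigma>"
proof -
  \<comment> \<open>Collinearity of \<open>x\<close> and \<open>g ** x\<close>, written as the
    vanishing of the 2x2 minors.\<close>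
  have parallel: "x $ i $ 1 * (g ** x) $ k $ 1 = x $ k $ 1 * (g ** x) $ i $ 1"
    if x: "x \<noteq> 0" "\<xi> \<noteq> 0" "\<xi> ** x = 0" for x :: "'a^1^'n" and \<xi> :: "'a^'n^1" and i k
  proof -
    let ?y = "g ** x" and ?\<eta> = "\<xi> ** matrix_inv g"
    obtain j where j: "\<xi> $ 1 $ j \<noteq> 0" using x(2) by (auto simp: vec_eq_iff num1_eq1)
    have "map_matrix \<sigma> g ** (map_matrix \<sigma> x ** \<xi>) ** matrix_inv g = map_matrix \<sigma> x ** \<xi>"
      using stab x unfolding flag_matrices_def by blast
    then have "map_matrix \<sigma> ?y ** ?\<eta> = map_matrix \<sigma> x ** \<xi>"
      by (simp add: map_matrix_automorphism_mult[OF \<sigma>] matrix_mul_assoc)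
    then have eq: "\<sigma> (?y $ l $ 1) * ?\<eta> $ 1 $ j = \<sigma> (x $ l $ 1) * \<xi> $ 1 $ j" for l
      unfolding vec_eq_iff column_times_row_nth by (simp add: map_matrix_def)
    \<comment> \<open>Using \<open>eq\<close> at \<open>i\<close> and at \<open>k\<close>, both
      sides become the product of two entries of \<open>?y\<close> under \<sigma> with entry
      \<open>j\<close> of \<open>?\<eta>\<close>. Only the nonzero entry \<open>j\<close> of
      \<open>\<xi>\<close> is cancelled.\<close>
    have "\<sigma> (x $ i $ 1) * \<sigma> (?y $ k $ 1) * \<xi> $ 1 $ j
        = \<sigma> (?y $ k $ 1) * (\<sigma> (x $ i $ 1) * \<xi> $ 1 $ j)" by simp
    also have "\<dots> = \<sigma> (?y $ i $ 1) * (\<sigma> (?y $ k $ 1) * ?\<eta> $ 1 $ j)"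
      unfolding eq[symmetric] by (simp only: ac_simps)
    also have "\<dots> = \<sigma> (x $ k $ 1) * \<sigma> (?y $ i $ 1) * \<xi> $ 1 $ j"
      unfolding eq by simp
    finally have "\<sigma> (x $ i $ 1 * ?y $ k $ 1) = \<sigma> (x $ k $ 1 * ?y $ i $ 1)"
      using j \<sigma> by (simp add: field_automorphism_def)
    then show ?thesis using \<sigma> unfolding field_automorphism_def by (metis bij_def inj_eq)
  qed
  \<comment> \<open>The flag is the unit vector at \<open>a\<close> with the coordinate functional
    at \<open>b\<close>; the minor compares \<open>g $ b $ a\<close> with 0.\<close>
  have off: "g $ b $ a = 0" if "a \<noteq> b" for a b
    using parallel[of "\<chi> i _. of_bool (i = a)" "\<chi> _ j. of_bool (j = b)" a b] that
    by (simp add: vec_eq_iff matrix_matrix_mult_def)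
  have diag: "g $ b $ b = g $ a $ a" if "a \<noteq> b" for a b
  proof -
    \<comment> \<open>The sum of two unit vectors is annihilated by the difference of their
      coordinate functionals. Its minor equates two row sums of \<open>g\<close>, in which
      \<open>off\<close> leaves only the diagonal entries.\<close>
    let ?x = "(\<chi> i _. of_bool (i = a) + of_bool (i = b)) :: 'a^1^'n"
    let ?\<xi> = "(\<chi> _ j. of_bool (j = a) - of_bool (j = b)) :: 'a^'n^1"
    have x: "?x $ a $ 1 = 1" "?x $ b $ 1 = 1" "?\<xi> $ 1 $ a = 1" using that by auto
    then have nz: "?x \<noteq> 0" "?\<xi> \<noteq> 0" by (metis zero_index zero_neq_one)+
    have "?\<xi> ** ?x = 0" "(g ** ?x) $ i $ 1 = g $ i $ a + g $ i $ b" for i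
      using that by (simp_all add: vec_eq_iff matrix_matrix_mult_def algebra_simps sum.distrib
          sum_subtractf)
    then show ?thesis
      using parallel[OF nz, of a b] off that by (simp add: x)
  qed
  obtain a b :: 'n where ab: "a \<noteq> b"
    using n by (metis card_2_iff' ex_card UNIV_I)
  define \<alpha> where "\<alpha> = g $ a $ a"
  have g_mat: "g = mat \<alpha>"
    using off diag[of a] by (auto simp: vec_eq_iff mat_def \<alpha>_def) metis
  have "\<alpha> \<noteq> 0" using g by (simp add: g_mat invertible_mat_iff)
  \<comment> \<open>One flag matrix with an entry equal to 1 detects the factor
    \<open>\<sigma> \<alpha> * inverse \<alpha>\<close> by which the scalar matrix acts.\<close>
  let ?x = "(\<chi> i _. of_bool (i = a)) :: 'a^1^'n"
  let ?\<xi> = "(\<chi> _ j. of_bool (j = b)) :: 'a^'n^1"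
  have "map_matrix \<sigma> ?x ** ?\<xi> \<in> flag_matrices \<sigma>"
    unfolding flag_matrices_def using ab
    by (intro CollectI exI[of _ ?x] exI[of _ ?\<xi>])
      (auto simp: vec_eq_iff matrix_matrix_mult_def)
  from stab[OF this] have "map_matrix ((*) (\<sigma> \<alpha> * inverse \<alpha>)) (map_matrix \<sigma> ?x ** ?\<xi>)
      = map_matrix \<sigma> ?x ** ?\<xi>"
    using \<open>\<alpha> \<noteq> 0\<close>
    by (simp add: g_mat matrix_inv_mat map_matrix_automorphism_mat[OF \<sigma>] mat_mult_eq_scale
        map_matrix_scale_scale mult.commute)
  then have "(\<sigma> \<alpha> * inverse \<alpha>) * (map_matrix \<sigma> ?x ** ?\<xi>) $ a $ b = (map_matrix \<sigma> ?x ** ?\<xi>) $ a $ b"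
    by (auto simp: vec_eq_iff map_matrix_def)
  moreover have "(map_matrix \<sigma> ?x ** ?\<xi>) $ a $ b = 1"
    using \<sigma> by (simp add: column_times_row_nth map_matrix_def field_automorphism_def)
  ultimately have "\<sigma> \<alpha> * inverse \<alpha> = 1" by simp
  then show ?thesis
    using \<open>\<alpha> \<noteq> 0\<close> unfolding K_scalars_def fixed_field_def g_mat
    by (auto simp: field_simps)
qed

section \<open>The action on the code and its kernel\<close>

theorem theorem1p3:
  fixes \<sigma> :: "'a::{field,finite} \<Rightarrow> 'a"
    and X :: "'k::finite \<Rightarrow> 'a^'n^'n"
    and n :: nat
  assumes "n \<ge> 1" and "CARD('n) = n + 1"
    and "field_automorphism \<sigma>" and "\<sigma> \<noteq> id"
    and "representatives X (Lambda \<sigma>)"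
  shows "\<exists>\<rho> :: 'a^'n^'n \<Rightarrow> 'a^'k \<Rightarrow> 'a^'k.
    (\<forall>g \<in> carrier GL. \<forall>M.
       \<rho> g (codeword X M) = codeword X (matrix_inv g ** M ** map_matrix \<sigma> g)) \<and>
    group_hom GL (code_aut (code X)) \<rho> \<and>
    kernel GL (code_aut (code X)) \<rho> = K_scalars \<sigma>"
proof -
  note \<sigma> = assms(3) and X = assms(5)
  obtain f where f: "\<And>g. invertible g \<Longrightarrow> hamming_isometry (f g)"
    and fc: "\<And>g M. invertible g \<Longrightarrow>
      f g (codeword X M) = codeword X (matrix_inv g ** M ** map_matrix \<sigma> g)"
    using codeword_twisted_conj_isometry[OF \<sigma> X] by metis
  \<comment> \<open>The isometries \<open>f g\<close> are chosen separately for each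
    \<open>g\<close> and are controlled only on codewords; restriction to the code makes the choice
    multiplicative.\<close>
  define \<rho> where "\<rho> g = restrict (f g) (code X)" for g
  have \<rho>_codeword: "\<rho> g (codeword X M) = codeword X (matrix_inv g ** M ** map_matrix \<sigma> g)"
    if "invertible g" for g M
    using fc[OF that] by (simp add: \<rho>_def code_def)
  have image: "f g ` code X = code X" if g: "invertible g" for g
  proof -
    \<comment> \<open>The preimage is found by twisted conjugation with the inverse of
      \<open>g\<close>.\<close>
    have "codeword X M = f g (codeword X (g ** M ** map_matrix \<sigma> (matrix_inv g)))" for M
    proof -
      have "matrix_inv g ** (g ** M ** map_matrix \<sigma> (matrix_inv g)) ** map_matrix \<sigma> g
          = (matrix_inv g ** g) ** M ** (map_matrix \<sigma> (matrix_inv g) ** map_matrix \<sigma> g)"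
        by (simp add: matrix_mul_assoc)
      then show ?thesis
        by (simp add: fc g matrix_inv_inverse map_matrix_automorphism_inv \<sigma>)
    qed
    then have "codeword X M \<in> f g ` code X" for M
      unfolding code_def by blast
    then show ?thesis unfolding code_def by (auto simp: fc[OF g])
  qed
  have carrier: "\<rho> g \<in> carrier (code_aut (code X))" if "invertible g" for g
    using f[OF that] image[OF that] by (auto simp: \<rho>_def code_aut_def)
  have mult: "\<rho> (g ** h) = \<rho> g \<otimes>\<^bsub>code_aut (code X)\<^esub> \<rho> h"
    if g: "invertible g" and h: "invertible h" for g h
  proof -
    \<comment> \<open>Inverting \<open>g ** h\<close> reverses the factors, so \<open>g\<close> acts
      first, in agreement with the left-to-right product of \<open>code_aut\<close>.\<close>
    have "f (g ** h) u = f h (f g u)" if "u \<in> code X" for u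
    proof -
      obtain M where "u = codeword X M" using \<open>u \<in> code X\<close> unfolding code_def by blast
      then show ?thesis
        by (simp add: fc g h invertible_mult matrix_inv_mult matrix_mul_assoc
            map_matrix_automorphism_mult[OF \<sigma>])
    qed
    then show ?thesis
      unfolding \<rho>_def code_aut_def
      by (simp add: compose_restrict_restrict image[OF g] cong: restrict_cong)
  qed
  have hom: "group_hom GL (code_aut (code X)) \<rho>"
    by (intro group_hom.intro group_GL group_code_aut group_hom_axioms.intro homI)
      (auto simp: GL_def carrier mult)
  have "\<rho> g = restrict id (code X) \<longleftrightarrow> g \<in> K_scalars \<sigma>" if g: "invertible g" for g
  proof
    assume *: "\<rho> g = restrict id (code X)"
    have fix_X: "map_matrix \<sigma> g ** X i ** matrix_inv g = X i" for i
    proof (rule eq_if_trace_mult_eq)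
      fix M
      have "codeword X (matrix_inv g ** M ** map_matrix \<sigma> g) = codeword X M"
        using * \<rho>_codeword[OF g, of M] by (simp add: code_def)
      then have "trace (X i ** M) = trace ((X i ** matrix_inv g ** M) ** map_matrix \<sigma> g)"
        by (simp add: codeword_def vec_eq_iff matrix_mul_assoc)
      also have "\<dots> = trace (map_matrix \<sigma> g ** X i ** matrix_inv g ** M)"
        by (subst trace_mul_sym) (simp add: matrix_mul_assoc)
      finally show "trace (map_matrix \<sigma> g ** X i ** matrix_inv g ** M) = trace (X i ** M)" ..
    qed
    show "g \<in> K_scalars \<sigma>"
    proof (rule twisted_conj_fixes_flags_imp_scalar[OF \<sigma> g])
      show "CARD('n) \<ge> 2" using assms(1,2) by simp
      fix A :: "'a^'n^'n" assume "A \<in> flag_matrices \<sigma>"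
      \<comment> \<open>Twisted conjugation commutes with scalars, so fixing the representatives
        fixes all their multiples.\<close>
      then obtain i c where "A = map_matrix ((*) c) (X i)"
        using flag_matrix_multiple_of_representative[OF \<sigma> X] by blast
      then show "map_matrix \<sigma> g ** A ** matrix_inv g = A"
        by (simp add: map_matrix_scale_mult fix_X)
    qed
  next
    assume "g \<in> K_scalars \<sigma>"
    then obtain \<alpha> where \<alpha>: "g = mat \<alpha>" "\<sigma> \<alpha> = \<alpha>" "\<alpha> \<noteq> 0"
      unfolding K_scalars_def fixed_field_def by blast
    have "matrix_inv g = mat (inverse \<alpha>)" using \<alpha> by (simp add: matrix_inv_mat)
    then have "matrix_inv g ** M ** map_matrix \<sigma> g = M" for M
      using \<alpha> by (simp add: map_matrix_automorphism_mat[OF \<sigma>] mat_mult_eq_scale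
          map_matrix_scale_scale map_matrix_one)
    then have "f g u = u" if "u \<in> code X" for u
      using that fc[OF g] by (auto simp: code_def)
    then show "\<rho> g = restrict id (code X)" by (auto simp: \<rho>_def restrict_def fun_eq_iff)
  qed
  \<comment> \<open>The kernel consists of elements of \<open>GL\<close>, so the equivalence for
    invertible \<open>g\<close> yields equality of sets once the scalars are known to lie in
    \<open>GL\<close>.\<close>
  moreover have "invertible g" if "g \<in> K_scalars \<sigma>" for g :: "'a^'n^'n"
    using that unfolding K_scalars_def by (auto simp: invertible_mat_iff)
  ultimately have "kernel GL (code_aut (code X)) \<rho> = K_scalars \<sigma>"
    unfolding kernel_def GL_def by (auto simp: code_aut_def)
  then show ?thesis
    using \<rho>_codeword hom by (intro exI[of _ \<rho>]) (auto simp: GL_def)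
qed

end
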